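(* Let $G=(V,E)$ be a finite simple graph in which every vertex has degree at least $1$, and suppose that $L = AD^{-1} - \mathrm{Id}_{n\times n}$, where $n=|V|$, has an orthogonal set of $n$ eigenvectors $\phi_1,\dots,\phi_n : V\to\mathbb{R}$ with corresponding eigenvalues $\lambda_1,\dots,\lambda_n$. Let $\lambda>0$ be a real number, and let $W\subset V$ be a nonempty subset equipped with positive weights $(a_w)_{w\in W}$ such that $$\sum_{w\in W} a_w\,\phi_j(w) = \frac{1}{|V|}\sum_{v\in V}\phi_j(v)$$ for all eigenvectors $\phi_j$ whose eigenvalue satisfies $|\lambda_j+1|\geq\lambda$. Then, for every $k\in\mathbb{N}$, $$\#\{x\in V : d(x,W)\leq k\} \;\geq\; \frac12\min\left\{\frac{1}{\lambda^{2k}},\,|V|\right\}.$$ Moreover, if all weights are identical, $a_w = 1/|W|$ for all $w\in W$, then for every $k\in\mathbb{N}$, $$\#\{x\in V : d(x,W)\leq k\} \;\geq\; \frac12\min\left\{\frac{|W|}{\lambda^{2k}},\,|V|\right\}.$$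
   Context: For a finite simple graph $G=(V,E)$ with $n=|V|$ vertices, $A$ denotes its adjacency matrix, $D$ the diagonal degree matrix (with $D_{vv}=\deg(v)$), and $\mathrm{Id}_{n\times n}$ the identity matrix. Vectors in $\mathbb{R}^n$ are identified with functions $V\to\mathbb{R}$, and $L=AD^{-1}-\mathrm{Id}_{n\times n}$ acts by $(Lf)(u)=\left(\sum_{v\sim u} \frac{f(v)}{\deg(v)}\right)-f(u)$, the sum being over the neighbors $v$ of $u$. Orthogonality of eigenvectors is with respect to the standard inner product $\langle f,g\rangle=\sum_{v\in V}f(v)g(v)$. For $x\in V$, $d(x,W)=\min_{w\in W}d(x,w)$, where $d$ is the graph (shortest path) distance, with $d=\infty$ between vertices in different connected components. *)

theory Defs
  imports "HOL-Analysis.Analysis" "HOL-Library.Extended_Nat"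
begin

text \<open>
  A finite simple graph is given by its adjacency relation on a finite vertex type: the vertex set
  is the whole type, so the number of vertices is \<open>CARD('v)\<close>, and a vector indexed by the vertices
  is an element of \<open>real ^ 'v\<close>.
\<close>

definition simple_graph :: "('v::finite \<Rightarrow> 'v \<Rightarrow> bool) \<Rightarrow> bool" where
  "simple_graph adj \<longleftrightarrow> symp adj \<and> irreflp adj"

definition vertex_degree :: "('v::finite \<Rightarrow> 'v \<Rightarrow> bool) \<Rightarrow> 'v \<Rightarrow> nat" where
  "vertex_degree adj u = card {v. adj u v}"

definition adjacency_matrix :: "('v::finite \<Rightarrow> 'v \<Rightarrow> bool) \<Rightarrow> real ^ 'v ^ 'v" where
  "adjacency_matrix adj = (\<chi> u v. if adj u v then 1 else 0)"

definition degree_matrix :: "('v::finite \<Rightarrow> 'v \<Rightarrow> bool) \<Rightarrow> real ^ 'v ^ 'v" where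
  "degree_matrix adj = (\<chi> u v. if u = v then real (vertex_degree adj u) else 0)"

definition graph_laplacian :: "('v::finite \<Rightarrow> 'v \<Rightarrow> bool) \<Rightarrow> real ^ 'v ^ 'v" where
  "graph_laplacian adj = adjacency_matrix adj ** matrix_inv (degree_matrix adj) - mat 1"

definition eigenvector :: "real ^ 'n ^ 'n \<Rightarrow> real ^ 'n \<Rightarrow> real \<Rightarrow> bool" where
  "eigenvector M f c \<longleftrightarrow> f \<noteq> 0 \<and> M *v f = c *\<^sub>R f"

text \<open>
  \<open>(adj ^^ m) u v\<close> says that there is a walk of length \<open>m\<close> from \<open>u\<close> to \<open>v\<close>. The infimum of the empty
  set in \<^typ>\<open>enat\<close> is \<open>\<infinity>\<close>, the distance between vertices in different components.
\<close>

definition graph_dist :: "('v::finite \<Rightarrow> 'v \<Rightarrow> bool) \<Rightarrow> 'v \<Rightarrow> 'v \<Rightarrow> enat" where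
  "graph_dist adj u v = (INF m\<in>{m. (adj ^^ m) u v}. enat m)"

text \<open>Meaningful for nonempty \<open>W\<close> only.\<close>

definition graph_setdist :: "('v::finite \<Rightarrow> 'v \<Rightarrow> bool) \<Rightarrow> 'v \<Rightarrow> 'v set \<Rightarrow> enat" where
  "graph_setdist adj x W = (MIN w\<in>W. graph_dist adj x w)"

text \<open>The inverse of the degree matrix is a genuine one, and the Laplacian acts as expected.\<close>

lemma graph_laplacian_apply:
  assumes deg: "\<forall>v. vertex_degree adj v \<ge> 1"
  shows "(graph_laplacian adj *v f) $ u = (\<Sum>v | adj u v. f $ v / real (vertex_degree adj v)) - f $ u"
proof -
  define B :: "real ^ 'a ^ 'a" where "B = (\<chi> u v. if u = v then 1 / real (vertex_degree adj u) else 0)"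
  have nz: "vertex_degree adj v > 0" for v
    using deg[rule_format, of v] by linarith
  have 1: "degree_matrix adj ** B = mat 1"
    by (simp add: vec_eq_iff matrix_matrix_mult_def degree_matrix_def B_def mat_def nz
        mult_delta_left)
  have 2: "B ** degree_matrix adj = mat 1"
    by (simp add: vec_eq_iff matrix_matrix_mult_def degree_matrix_def B_def mat_def nz
        mult_delta_left)
  have "matrix_inv (degree_matrix adj) ** degree_matrix adj = mat 1"
    unfolding matrix_inv_def by (rule someI2[of _ B]) (use 1 2 in simp_all)
  then have inv: "matrix_inv (degree_matrix adj) = B"
    using 1 matrix_mul_assoc[of "matrix_inv (degree_matrix adj)" "degree_matrix adj" B] by simp
  have Bf: "(B *v f) $ v = f $ v / real (vertex_degree adj v)" for v
    by (simp add: matrix_vector_mult_def B_def mult_delta_left)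
  have "(graph_laplacian adj *v f) $ u = (adjacency_matrix adj *v (B *v f)) $ u - f $ u"
    by (simp add: graph_laplacian_def inv matrix_vector_mult_diff_rdistrib matrix_vector_mul_assoc)
  also have "(adjacency_matrix adj *v (B *v f)) $ u
      = (\<Sum>v\<in>UNIV. if adj u v then f $ v / real (vertex_degree adj v) else 0)"
    unfolding matrix_vector_mult_def[of "adjacency_matrix adj"]
    by (auto simp: adjacency_matrix_def Bf intro!: sum.cong)
  also have "\<dots> = (\<Sum>v | adj u v. f $ v / real (vertex_degree adj v))"
    by (simp add: sum.If_cases)
  finally show ?thesis .
qed

end

theory Submission
  imports Defs
begin

text \<open>
  Write \<open>P = A D\<^sup>-\<^sup>1\<close> for the transition operator of the random walk and \<open>\<mu>\<^sub>j = \<lambda>\<^sub>j + 1\<close> for its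
  eigenvalues. Spread the weights over the graph: let \<open>f = \<Sum>\<^sub>w a\<^sub>w \<delta>\<^sub>w\<close> and look at \<open>g = P\<^sup>k f\<close>. Three facts
  about \<open>g\<close> compete with each other.

  \<^item> \<open>g\<close> lives on the \<open>k\<close>-neighbourhood \<open>S\<close> of \<open>W\<close>, because each application of \<open>P\<close> moves mass along one
    edge (\<open>walk_step_funpow_support\<close>).

  \<^item> \<open>g\<close> has the same total mass as \<open>f\<close>, because the columns of \<open>P\<close> sum to one (\<open>walk_step_mass\<close>).

  \<^item> \<open>g\<close> is nearly flat. The hypothesis on \<open>W\<close> says that \<open>h = f - 1/n\<close> is orthogonal to every \<open>\<phi>\<^sub>j\<close> with
    \<open>\<bar>\<mu>\<^sub>j\<bar> \<ge> \<lambda>\<close>, so each application of \<open>P\<close> shrinks \<open>h\<close> by the factor \<open>\<lambda>\<close>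
    (\<open>eigenbasis_funpow_contraction\<close>).

  The vector of ones is fixed by \<open>P\<close>: conservation of mass forces \<open>1 \<bottom> \<phi>\<^sub>j\<close> whenever \<open>\<mu>\<^sub>j \<noteq> 1\<close>. If
  \<open>\<lambda> \<le> 1\<close>, then \<open>h\<close> is orthogonal to the remaining \<open>\<phi>\<^sub>j\<close>, so \<open>h \<bottom> 1\<close>; that is, the total mass is
  one, and by Pythagoras \<open>\<parallel>g\<parallel>\<^sup>2 = 1/n + \<parallel>P\<^sup>k h\<parallel>\<^sup>2 \<le> 1/n + \<lambda>\<^sup>2\<^sup>k \<parallel>f\<parallel>\<^sup>2\<close>
  (\<open>design_energy_decay\<close>). Cauchy-Schwarz on \<open>S\<close> now gives \<open>1 \<le> |S| \<parallel>g\<parallel>\<^sup>2\<close>, and it remains to bound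
  \<open>\<parallel>f\<parallel>\<^sup>2 = \<Sum> a\<^sub>w\<^sup>2\<close>, which is at most \<open>(\<Sum> a\<^sub>w)\<^sup>2 = 1\<close> in general and equals \<open>1/|W|\<close> for equal weights.
  If \<open>\<lambda> > 1\<close>, both bounds are immediate from \<open>W \<subseteq> S\<close>.
\<close>

section \<open>Operators with an orthogonal eigenbasis\<close>

lemma orthogonal_family_span:
  fixes e :: "'i \<Rightarrow> 'a::euclidean_space"
  assumes "finite I" "card I = DIM('a)"
    and orth: "pairwise (\<lambda>i j. orthogonal (e i) (e j)) I"
    and nz: "\<forall>i\<in>I. e i \<noteq> 0"
  shows "span (e ` I) = UNIV"
proof -
  have inj: "inj_on e I"
  proof (rule inj_onI, rule ccontr)
    fix i j assume ij: "i \<in> I" "j \<in> I" "e i = e j" "i \<noteq> j"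
    then have "orthogonal (e i) (e j)"
      using orth by (auto simp: pairwise_def)
    then show False
      using ij nz by (simp add: orthogonal_def)
  qed
  have "pairwise orthogonal (e ` I)"
    using orth by (auto simp: pairwise_def)
  moreover have "0 \<notin> e ` I"
    using nz by auto
  ultimately have "independent (e ` I)"
    by (rule pairwise_orthogonal_independent)
  moreover have "dim (UNIV :: 'a set) \<le> card (e ` I)"
    by (simp add: card_image[OF inj] assms)
  ultimately show ?thesis
    using card_ge_dim_independent[of "e ` I" UNIV] by auto
qed

lemma orthogonal_basis_parseval:
  fixes e :: "'i \<Rightarrow> 'a::euclidean_space"
  assumes I: "finite I" "card I = DIM('a)"
    and orth: "pairwise (\<lambda>i j. orthogonal (e i) (e j)) I"
    and nz: "\<forall>i\<in>I. e i \<noteq> 0"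
  shows "x \<bullet> y = (\<Sum>i\<in>I. (x \<bullet> e i) * (y \<bullet> e i) / (e i \<bullet> e i))"
proof -
  define E where "E = (\<lambda>x. \<Sum>i\<in>I. ((x \<bullet> e i) / (e i \<bullet> e i)) *\<^sub>R e i)"
  have lin: "linear E"
    unfolding E_def
    by (rule linearI)
       (simp_all add: inner_add_left add_divide_distrib scaleR_add_left sum.distrib scaleR_sum_right)
  have fixed: "E (e j) = e j" if "j \<in> I" for j
  proof -
    have "E (e j) = (\<Sum>i\<in>I. if i = j then e j else 0)"
      unfolding E_def
    proof (rule sum.cong)
      fix i assume "i \<in> I"
      then show "((e j \<bullet> e i) / (e i \<bullet> e i)) *\<^sub>R e i = (if i = j then e j else 0)"
        using orth that nz by (auto simp: pairwise_def orthogonal_def)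
    qed simp
    also have "\<dots> = e j"
      using that I by simp
    finally show ?thesis .
  qed
  have "E x = x"
    using linear_eq_on_span[OF lin linear_ident, of "e ` I" x] fixed
      orthogonal_family_span[OF I orth nz] by auto
  then have "x \<bullet> y = E x \<bullet> y"
    by simp
  also have "\<dots> = (\<Sum>i\<in>I. (x \<bullet> e i) * (y \<bullet> e i) / (e i \<bullet> e i))"
    unfolding E_def by (simp add: inner_sum_left inner_commute[of "e i" y for i])
  finally show ?thesis .
qed

text \<open>
  Both sides are linear in \<open>x\<close>, and on the basis they agree by orthogonality. This gives access to the
  coordinates of \<open>P x\<close> without first showing that \<open>P\<close> is symmetric.
\<close>

lemma eigenbasis_inner:
  fixes e :: "'i \<Rightarrow> 'a::euclidean_space"
  assumes I: "finite I" "card I = DIM('a)"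
    and orth: "pairwise (\<lambda>i j. orthogonal (e i) (e j)) I"
    and nz: "\<forall>i\<in>I. e i \<noteq> 0"
    and P: "linear P" "\<forall>i\<in>I. P (e i) = \<mu> i *\<^sub>R e i"
    and j: "j \<in> I"
  shows "P x \<bullet> e j = \<mu> j * (x \<bullet> e j)"
proof -
  have "linear (\<lambda>x. P x \<bullet> e j)"
    using P(1) by (intro linearI) (simp_all add: linear_add linear_scale inner_add_left)
  moreover have "linear (\<lambda>x. \<mu> j * (x \<bullet> e j))"
    by (intro linearI) (simp_all add: inner_add_left distrib_left)
  moreover have "P b \<bullet> e j = \<mu> j * (b \<bullet> e j)" if "b \<in> e ` I" for b
  proof -
    from that obtain i where i: "i \<in> I" "b = e i" by blast
    then show ?thesis
      using orth P(2) j by (cases "i = j") (auto simp: pairwise_def orthogonal_def)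
  qed
  ultimately show ?thesis
    using linear_eq_on_span[of "\<lambda>x. P x \<bullet> e j" "\<lambda>x. \<mu> j * (x \<bullet> e j)" "e ` I" x]
      orthogonal_family_span[OF I orth nz] by auto
qed

lemma eigenbasis_contraction:
  fixes e :: "'i \<Rightarrow> 'a::euclidean_space"
  assumes I: "finite I" "card I = DIM('a)"
    and orth: "pairwise (\<lambda>i j. orthogonal (e i) (e j)) I"
    and nz: "\<forall>i\<in>I. e i \<noteq> 0"
    and P: "linear P" "\<forall>i\<in>I. P (e i) = \<mu> i *\<^sub>R e i"
    and h: "\<forall>i\<in>I. \<bar>\<mu> i\<bar> \<ge> c \<longrightarrow> h \<bullet> e i = 0"
  shows "P h \<bullet> P h \<le> c\<^sup>2 * (h \<bullet> h)"
proof -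
  have "P h \<bullet> P h = (\<Sum>i\<in>I. (\<mu> i)\<^sup>2 * (h \<bullet> e i)\<^sup>2 / (e i \<bullet> e i))"
    unfolding orthogonal_basis_parseval[OF I orth nz, of "P h" "P h"]
    by (rule sum.cong) (simp_all add: eigenbasis_inner[OF I orth nz P] power2_eq_square)
  also have "\<dots> \<le> (\<Sum>i\<in>I. c\<^sup>2 * (h \<bullet> e i)\<^sup>2 / (e i \<bullet> e i))"
  proof (rule sum_mono)
    fix i assume i: "i \<in> I"
    show "(\<mu> i)\<^sup>2 * (h \<bullet> e i)\<^sup>2 / (e i \<bullet> e i) \<le> c\<^sup>2 * (h \<bullet> e i)\<^sup>2 / (e i \<bullet> e i)"
    proof (cases "\<bar>\<mu> i\<bar> \<ge> c")
      case True
      then show ?thesis using h i by simp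
    next
      case False
      then have "(\<mu> i)\<^sup>2 \<le> c\<^sup>2"
        by (simp add: abs_le_square_iff[symmetric])
      then show ?thesis
        by (intro divide_right_mono mult_right_mono) simp_all
    qed
  qed
  also have "\<dots> = c\<^sup>2 * (h \<bullet> h)"
    unfolding orthogonal_basis_parseval[OF I orth nz, of h h]
    by (simp add: sum_distrib_left power2_eq_square mult.assoc)
  finally show ?thesis .
qed

lemma eigenbasis_funpow_contraction:
  fixes e :: "'i \<Rightarrow> 'a::euclidean_space"
  assumes I: "finite I" "card I = DIM('a)"
    and orth: "pairwise (\<lambda>i j. orthogonal (e i) (e j)) I"
    and nz: "\<forall>i\<in>I. e i \<noteq> 0"
    and P: "linear P" "\<forall>i\<in>I. P (e i) = \<mu> i *\<^sub>R e i"
    and h: "\<forall>i\<in>I. \<bar>\<mu> i\<bar> \<ge> c \<longrightarrow> h \<bullet> e i = 0"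
  shows "(P ^^ k) h \<bullet> (P ^^ k) h \<le> c ^ (2 * k) * (h \<bullet> h)"
proof (induction k)
  case (Suc k)
  \<comment> \<open>The coordinates of \<open>h\<close> that vanish keep vanishing, so the one-step bound can be iterated.\<close>
  have "\<forall>i\<in>I. \<bar>\<mu> i\<bar> \<ge> c \<longrightarrow> (P ^^ m) h \<bullet> e i = 0" for m
    by (induction m) (simp_all add: h eigenbasis_inner[OF I orth nz P])
  then have "P ((P ^^ k) h) \<bullet> P ((P ^^ k) h) \<le> c\<^sup>2 * ((P ^^ k) h \<bullet> (P ^^ k) h)"
    by (intro eigenbasis_contraction[OF I orth nz P])
  also have "\<dots> \<le> c\<^sup>2 * (c ^ (2 * k) * (h \<bullet> h))"
    by (intro mult_left_mono Suc) simp
  finally show ?case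
    by (simp add: power_add power2_eq_square mult.assoc)
qed simp

section \<open>The random walk\<close>

definition walk_step :: "('v::finite \<Rightarrow> 'v \<Rightarrow> bool) \<Rightarrow> real ^ 'v \<Rightarrow> real ^ 'v" where
  "walk_step adj f = graph_laplacian adj *v f + f"

lemma linear_walk_step: "linear (walk_step adj)"
  unfolding walk_step_def
  by (intro linearI)
     (simp_all add: matrix_vector_right_distrib matrix_vector_mult_scaleR scaleR_add_right)

lemma linear_walk_step_funpow: "linear (walk_step adj ^^ k)"
  by (induction k) (auto simp: linear_compose[unfolded o_def] linear_walk_step o_def linear_ident id_def)

lemma walk_step_apply:
  assumes "\<forall>v. vertex_degree adj v \<ge> 1"
  shows "walk_step adj f $ u = (\<Sum>v | adj u v. f $ v / real (vertex_degree adj v))"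
  by (simp add: walk_step_def graph_laplacian_apply[OF assms])

text \<open>Each vertex \<open>v\<close> hands its mass out in \<open>deg v\<close> equal parts to its neighbours.\<close>

lemma walk_step_mass:
  assumes "simple_graph adj" and deg: "\<forall>v. vertex_degree adj v \<ge> 1"
  shows "walk_step adj f \<bullet> 1 = f \<bullet> 1"
proof -
  have sym: "adj u v \<longleftrightarrow> adj v u" for u v
    using assms(1) by (auto simp: simple_graph_def symp_def)
  have nz: "vertex_degree adj v \<noteq> 0" for v
    using deg[rule_format, of v] by simp
  have "walk_step adj f \<bullet> 1 = (\<Sum>u\<in>UNIV. \<Sum>v | adj u v. f $ v / real (vertex_degree adj v))"
    by (simp add: inner_vec_def walk_step_apply[OF deg])
  also have "\<dots> = (\<Sum>v\<in>UNIV. \<Sum>u | adj u v. f $ v / real (vertex_degree adj v))"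
    using sum.swap_restrict[of UNIV UNIV "\<lambda>u v. f $ v / real (vertex_degree adj v)" adj] by simp
  also have "\<dots> = (\<Sum>v\<in>UNIV. f $ v)"
    using nz by (simp add: sym[of _ v for v] vertex_degree_def[symmetric])
  also have "\<dots> = f \<bullet> 1"
    by (simp add: inner_vec_def)
  finally show ?thesis .
qed

lemma walk_step_funpow_mass:
  assumes "simple_graph adj" "\<forall>v. vertex_degree adj v \<ge> 1"
  shows "(walk_step adj ^^ k) f \<bullet> 1 = f \<bullet> 1"
  by (induction k) (simp_all add: walk_step_mass[OF assms])

lemma walk_step_funpow_support:
  assumes deg: "\<forall>v. vertex_degree adj v \<ge> 1"
    and f: "\<And>v. f $ v \<noteq> 0 \<Longrightarrow> v \<in> W"
    and "(walk_step adj ^^ k) f $ x \<noteq> 0"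
  shows "\<exists>w\<in>W. (adj ^^ k) x w"
  using assms(3)
proof (induction k arbitrary: x)
  case 0
  then show ?case using f by auto
next
  case (Suc k)
  then obtain v where v: "adj x v" "(walk_step adj ^^ k) f $ v \<noteq> 0"
    by (auto simp: walk_step_apply[OF deg] elim!: sum.not_neutral_contains_not_neutral)
  then show ?case
    using Suc.IH[OF v(2)] by (blast intro: relpowp_Suc_I2)
qed

lemma graph_setdist_le:
  assumes "w \<in> W" "(adj ^^ k) x w"
  shows "graph_setdist adj x W \<le> enat k"
proof -
  have "graph_setdist adj x W \<le> graph_dist adj x w"
    unfolding graph_setdist_def using assms(1) by (intro Min_le) auto
  also have "\<dots> \<le> enat k"
    unfolding graph_dist_def using assms(2) by (intro INF_lower) simp
  finally show ?thesis .
qed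

lemma subset_graph_neighbourhood: "W \<subseteq> {x. graph_setdist adj x W \<le> enat k}"
proof
  fix w assume "w \<in> W"
  then have "graph_setdist adj w W \<le> enat 0"
    by (rule graph_setdist_le) simp
  also have "enat 0 \<le> enat k"
    by simp
  finally show "w \<in> {x. graph_setdist adj x W \<le> enat k}"
    by simp
qed

lemma sum_square_le_card_mult:
  fixes g :: "real ^ 'v::finite"
  assumes "\<And>x. x \<notin> S \<Longrightarrow> g $ x = 0"
  shows "(g \<bullet> 1)\<^sup>2 \<le> real (card S) * (g \<bullet> g)"
proof -
  have "g \<bullet> 1 = (\<Sum>x\<in>S. g $ x)"
    unfolding inner_vec_def using assms by (simp, intro sum.mono_neutral_right) auto
  then have "(g \<bullet> 1)\<^sup>2 \<le> real (card S) * (\<Sum>x\<in>S. (g $ x)\<^sup>2)"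
    using Cauchy_Schwarz_ineq_sum[of "\<lambda>x. g $ x" "\<lambda>_. 1" S] by (simp add: mult.commute)
  also have "(\<Sum>x\<in>S. (g $ x)\<^sup>2) \<le> g \<bullet> g"
    unfolding inner_vec_def by (simp add: power2_eq_square sum_mono2)
  finally show ?thesis
    by (simp add: mult_left_mono)
qed

section \<open>Designs and the growth of neighbourhoods\<close>

text \<open>
  The total mass is determined because \<open>c \<le> 1\<close> puts the eigenvalue \<open>1\<close> of the constant vector among those
  whose eigenvectors \<open>f\<close> averages exactly. That vector need not be one of the \<open>\<phi> j\<close>, since the eigenvalue
  may be multiple, so it is handled through its coordinates.
\<close>

lemma design_energy_decay:
  fixes adj :: "'v::finite \<Rightarrow> 'v \<Rightarrow> bool" and f :: "real ^ 'v"
  assumes G: "simple_graph adj" "\<forall>v. vertex_degree adj v \<ge> 1"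
    and I: "finite I" "card I = CARD('v)"
    and eig: "\<forall>j\<in>I. eigenvector (graph_laplacian adj) (\<phi> j) (ev j)"
    and orth: "pairwise (\<lambda>i j. orthogonal (\<phi> i) (\<phi> j)) I"
    and c: "c \<le> 1"
    and design: "\<forall>j\<in>I. \<bar>ev j + 1\<bar> \<ge> c \<longrightarrow> f \<bullet> \<phi> j = (1 \<bullet> \<phi> j) / real CARD('v)"
  shows "f \<bullet> 1 = 1"
    and "(walk_step adj ^^ k) f \<bullet> (walk_step adj ^^ k) f \<le> 1 / real CARD('v) + c ^ (2 * k) * (f \<bullet> f)"
proof -
  let ?P = "walk_step adj" and ?n = "real CARD('v)"
  have I': "card I = DIM(real ^ 'v)"
    using I(2) by simp
  have nz: "\<forall>j\<in>I. \<phi> j \<noteq> 0"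
    using eig by (simp add: eigenvector_def)
  have Peig: "\<forall>j\<in>I. ?P (\<phi> j) = (ev j + 1) *\<^sub>R \<phi> j"
    using eig by (simp add: eigenvector_def walk_step_def scaleR_add_left)
  note parseval = orthogonal_basis_parseval[OF I(1) I' orth nz]
    and coord = eigenbasis_inner[OF I(1) I' orth nz linear_walk_step Peig]
  have ones: "1 \<bullet> \<phi> j = 0" if "j \<in> I" "ev j \<noteq> 0" for j
    using walk_step_mass[OF G, of "\<phi> j"] that by (simp add: Peig inner_commute algebra_simps)
  have one_one: "(1 :: real ^ 'v) \<bullet> 1 = ?n"
    by (simp add: inner_vec_def)
  have P_one: "?P 1 = 1"
  proof -
    have "(?P 1 - 1) \<bullet> \<phi> j = 0" if "j \<in> I" for j
      using ones[OF that] by (cases "ev j = 0") (simp_all add: inner_diff_left that coord)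
    then have "(?P 1 - 1) \<bullet> (?P 1 - 1) = 0"
      by (subst parseval) simp_all
    then show ?thesis by simp
  qed
  define h where "h = f - (1 / ?n) *\<^sub>R 1"
  have h_coord: "\<forall>j\<in>I. \<bar>ev j + 1\<bar> \<ge> c \<longrightarrow> h \<bullet> \<phi> j = 0"
    using design by (simp add: h_def inner_diff_left)
  have h_one: "h \<bullet> 1 = 0"
  proof -
    have "(h \<bullet> \<phi> j) * (1 \<bullet> \<phi> j) = 0" if "j \<in> I" for j
      using ones[OF that] h_coord that c by (cases "ev j = 0") auto
    then show ?thesis
      by (subst parseval) (simp add: sum.neutral del: mult_eq_0_iff)
  qed
  then show "f \<bullet> 1 = 1"
    by (simp add: h_def inner_diff_left one_one)
  have P_one_funpow: "(?P ^^ m) 1 = 1" for m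
    by (induction m) (simp_all add: P_one)
  have f_eq: "f = h + (1 / ?n) *\<^sub>R 1"
    by (simp add: h_def)
  have pythagoras: "(u + (1 / ?n) *\<^sub>R 1) \<bullet> (u + (1 / ?n) *\<^sub>R 1) = u \<bullet> u + 1 / ?n" if "u \<bullet> 1 = 0"
    for u :: "real ^ 'v"
    using that by (simp add: inner_add_left inner_add_right one_one inner_commute[of 1 u])
  have "(?P ^^ k) f = (?P ^^ k) h + (1 / ?n) *\<^sub>R 1"
    unfolding f_eq
    by (simp add: linear_add[OF linear_walk_step_funpow] linear_scale[OF linear_walk_step_funpow] P_one_funpow)
  then have "(?P ^^ k) f \<bullet> (?P ^^ k) f = (?P ^^ k) h \<bullet> (?P ^^ k) h + 1 / ?n"
    using pythagoras[of "(?P ^^ k) h"] h_one by (simp add: walk_step_funpow_mass[OF G])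
  also have "\<dots> \<le> c ^ (2 * k) * (h \<bullet> h) + 1 / ?n"
    using eigenbasis_funpow_contraction[OF I(1) I' orth nz linear_walk_step Peig h_coord] by simp
  also have "\<dots> \<le> c ^ (2 * k) * (f \<bullet> f) + 1 / ?n"
  proof -
    have "h \<bullet> h \<le> f \<bullet> f"
      using pythagoras[OF h_one] by (simp add: f_eq[symmetric])
    then show ?thesis
      by (simp add: mult_left_mono)
  qed
  finally show "(?P ^^ k) f \<bullet> (?P ^^ k) f \<le> 1 / ?n + c ^ (2 * k) * (f \<bullet> f)"
    by simp
qed

text \<open>The factor \<open>1/2\<close> arises here: a sum of two terms is at most twice the larger one.\<close>

lemma half_min_le:
  fixes s n t B :: real
  assumes "s > 0" "n > 0" "t > 0" "B > 0" "1 \<le> s * (1 / n + t / B)"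
  shows "1 / 2 * min (B / t) n \<le> s"
proof -
  define m where "m = min (B / t) n"
  have m: "m > 0"
    using assms by (simp add: m_def)
  have "1 / n \<le> 1 / m"
    using assms m by (intro divide_left_mono) (auto simp: m_def)
  moreover have "t / B \<le> 1 / m"
  proof -
    have "1 / (B / t) \<le> 1 / m"
      using assms m by (intro divide_left_mono) (auto simp: m_def)
    then show ?thesis by simp
  qed
  ultimately have "s * (1 / n + t / B) \<le> s * (2 / m)"
    using assms by (intro mult_left_mono) auto
  then have "1 \<le> s * (2 / m)"
    using assms by linarith
  then show ?thesis
    using m by (simp add: m_def[symmetric] field_simps)
qed

text \<open>
  Both bounds of the theorem are instances, \<open>B = 1\<close> for general weights and \<open>B = |W|\<close> for equal ones. The
  energy bound is conditional on \<open>\<Sum> a\<^sub>w = 1\<close> because this is derived only for \<open>lam \<le> 1\<close>; for \<open>lam > 1\<close>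
  the bound \<open>B \<le> |W|\<close> takes over.
\<close>

lemma design_neighbourhood_card:
  fixes adj :: "'v::finite \<Rightarrow> 'v \<Rightarrow> bool"
  assumes G: "simple_graph adj" "\<forall>v. vertex_degree adj v \<ge> 1"
    and I: "finite I" "card I = CARD('v)"
    and eig: "\<forall>j\<in>I. eigenvector (graph_laplacian adj) (\<phi> j) (ev j)"
    and orth: "pairwise (\<lambda>i j. orthogonal (\<phi> i) (\<phi> j)) I"
    and lam: "lam > 0"
    and design: "\<forall>j\<in>I. \<bar>ev j + 1\<bar> \<ge> lam \<longrightarrow>
           (\<Sum>w\<in>W. a w * \<phi> j $ w) = 1 / real CARD('v) * (\<Sum>v\<in>UNIV. \<phi> j $ v)"
    and B: "0 < B" "B \<le> real (card W)"
    and energy: "(\<Sum>w\<in>W. a w) = 1 \<Longrightarrow> (\<Sum>w\<in>W. (a w)\<^sup>2) \<le> 1 / B"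
  shows "real (card {x. graph_setdist adj x W \<le> enat k}) \<ge> 1 / 2 * min (B / lam ^ (2 * k)) (real CARD('v))"
proof -
  let ?S = "{x. graph_setdist adj x W \<le> enat k}"
  have "card W \<le> card ?S"
    by (intro card_mono subset_graph_neighbourhood) simp
  then have S: "B \<le> real (card ?S)"
    using B(2) by linarith
  show ?thesis
  proof (cases "lam \<le> 1")
    case False
    then have "B / lam ^ (2 * k) \<le> B / 1"
      using B by (intro divide_left_mono one_le_power) auto
    then have "min (B / lam ^ (2 * k)) (real CARD('v)) \<le> B"
      by simp
    then show ?thesis
      using S B(1) by linarith
  next
    case True
    define f :: "real ^ 'v" where "f = (\<chi> v. if v \<in> W then a v else 0)"
    define g where "g = (walk_step adj ^^ k) f"
    have f_inner: "f \<bullet> y = (\<Sum>w\<in>W. a w * y $ w)" for y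
      by (simp add: f_def inner_vec_def if_distrib[of "\<lambda>z. z * _"] sum.If_cases cong: if_cong)
    have f_design: "\<forall>j\<in>I. \<bar>ev j + 1\<bar> \<ge> lam \<longrightarrow> f \<bullet> \<phi> j = (1 \<bullet> \<phi> j) / real CARD('v)"
      using design unfolding f_inner by (simp add: inner_vec_def)
    note decay = design_energy_decay[OF G I eig orth True f_design]
    have f_mass: "f \<bullet> 1 = 1"
      by (rule decay(1))
    have f_energy: "f \<bullet> f \<le> 1 / B"
    proof -
      have "f \<bullet> f = (\<Sum>w\<in>W. (a w)\<^sup>2)"
        unfolding f_inner by (rule sum.cong) (simp_all add: f_def power2_eq_square)
      then show ?thesis
        using energy f_mass by (simp add: f_inner)
    qed
    have "x \<in> ?S" if "g $ x \<noteq> 0" for x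
    proof -
      have "v \<in> W" if "f $ v \<noteq> 0" for v
        using that by (auto simp: f_def split: if_splits)
      then obtain w where "w \<in> W" "(adj ^^ k) x w"
        using walk_step_funpow_support[OF G(2)] \<open>g $ x \<noteq> 0\<close> unfolding g_def by blast
      then show ?thesis
        by (simp add: graph_setdist_le)
    qed
    then have "(g \<bullet> 1)\<^sup>2 \<le> real (card ?S) * (g \<bullet> g)"
      by (intro sum_square_le_card_mult) blast
    moreover have "g \<bullet> 1 = 1"
      using f_mass by (simp add: g_def walk_step_funpow_mass[OF G])
    ultimately have "1 \<le> real (card ?S) * (g \<bullet> g)"
      by simp
    also have "\<dots> \<le> real (card ?S) * (1 / real CARD('v) + lam ^ (2 * k) * (f \<bullet> f))"
      unfolding g_def by (intro mult_left_mono decay(2)) simp_all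
    also have "\<dots> \<le> real (card ?S) * (1 / real CARD('v) + lam ^ (2 * k) * (1 / B))"
      using lam by (intro mult_left_mono add_left_mono f_energy) simp_all
    finally have "1 \<le> real (card ?S) * (1 / real CARD('v) + lam ^ (2 * k) / B)"
      by simp
    then show ?thesis
      using B(1) S lam by (intro half_min_le) auto
  qed
qed

theorem mainTheorem1:
  fixes adj :: "'v::finite \<Rightarrow> 'v \<Rightarrow> bool"
    and \<phi> :: "nat \<Rightarrow> real ^ 'v"
    and ev :: "nat \<Rightarrow> real"
    and lam :: real
    and W :: "'v set"
    and a :: "'v \<Rightarrow> real"
  assumes "simple_graph adj"
    and "\<forall>v. vertex_degree adj v \<ge> 1"
    and "\<forall>j\<in>{1..CARD('v)}. eigenvector (graph_laplacian adj) (\<phi> j) (ev j)"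
    and "pairwise (\<lambda>i j. orthogonal (\<phi> i) (\<phi> j)) {1..CARD('v)}"
    and "lam > 0"
    and "W \<noteq> {}"
    and "\<forall>w\<in>W. a w > 0"
    and "\<forall>j\<in>{1..CARD('v)}. \<bar>ev j + 1\<bar> \<ge> lam \<longrightarrow>
           (\<Sum>w\<in>W. a w * \<phi> j $ w) = 1 / real CARD('v) * (\<Sum>v\<in>UNIV. \<phi> j $ v)"
  shows "(\<forall>k::nat. real (card {x. graph_setdist adj x W \<le> enat k})
             \<ge> 1 / 2 * min (1 / lam ^ (2 * k)) (real CARD('v)))
       \<and> ((\<forall>w\<in>W. a w = 1 / real (card W)) \<longrightarrow>
           (\<forall>k::nat. real (card {x. graph_setdist adj x W \<le> enat k})
              \<ge> 1 / 2 * min (real (card W) / lam ^ (2 * k)) (real CARD('v))))"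
proof (intro conjI allI impI)
  have W: "real (card W) \<ge> 1"
    using assms(6) by (simp add: Suc_le_eq card_gt_0_iff)
  have "card {1..CARD('v)} = CARD('v)"
    by simp
  note bound = design_neighbourhood_card[OF assms(1,2) finite_atLeastAtMost this
      assms(3-5,8)]
  fix k
  have "(\<Sum>w\<in>W. (a w)\<^sup>2) \<le> 1 / 1" if "(\<Sum>w\<in>W. a w) = 1"
  proof -
    have "(a w)\<^sup>2 \<le> a w" if "w \<in> W" for w
    proof -
      have "a w \<le> (\<Sum>w\<in>W. a w)"
        using that assms(7) by (intro member_le_sum) (auto simp: less_imp_le)
      then show ?thesis
        using \<open>(\<Sum>w\<in>W. a w) = 1\<close> that assms(7) mult_left_mono[of "a w" 1 "a w"]
        by (simp add: power2_eq_square less_imp_le)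
    qed
    then have "(\<Sum>w\<in>W. (a w)\<^sup>2) \<le> (\<Sum>w\<in>W. a w)"
      by (rule sum_mono)
    then show ?thesis
      using that by simp
  qed
  then show "real (card {x. graph_setdist adj x W \<le> enat k})
      \<ge> 1 / 2 * min (1 / lam ^ (2 * k)) (real CARD('v))"
    using W by (intro bound) auto
  show "real (card {x. graph_setdist adj x W \<le> enat k})
      \<ge> 1 / 2 * min (real (card W) / lam ^ (2 * k)) (real CARD('v))"
    if "\<forall>w\<in>W. a w = 1 / real (card W)"
  proof -
    have "(\<Sum>w\<in>W. (a w)\<^sup>2) = 1 / real (card W)"
      using that W by (simp add: power2_eq_square)
    then show ?thesis
      using W by (intro bound) auto
  qed
qed

end
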